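(* Let $M,N$ be non-negative integers and let $q,a,b,c,b',c',d$ be nonzero complex numbers with $|q|<1$, such that no denominator appearing below vanishes. Then $$\sum_{n=0}^{M}\sum_{l=0}^{N}\frac{(qa/d;q)_{n+l}}{(qa;q)_{n+l}}\cdot\frac{(b,c,q^{-M};q)_n}{(q,\,qa/d,\,bcq^{-M}/a;q)_n}\cdot\frac{(b',c',q^{-N};q)_l}{(q,\,qa/d,\,b'c'q^{-N}/a;q)_l}\,q^{n+l}$$ $$=\frac{(qa/b,\,qa/c;q)_M}{(qa,\,qa/(bc);q)_M}\cdot\frac{(qa/b',\,qa/c';q)_N}{(qa,\,qa/(b'c');q)_N}\;{}_{10}W_9\!\left(a;d,b,c,b',c',q^{-M},q^{-N};q,\frac{a^3q^{3+M+N}}{bcb'c'd}\right).$$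
   Context: Notation: $(x;q)_n=\prod_{j=0}^{n-1}(1-xq^j)$ for integers $n\ge0$, and $(x_1,\dots,x_r;q)_n=\prod_{i}(x_i;q)_n$. The very-well-poised series is $${}_{r+1}W_r(a;a_1,\dots,a_{r-2};q,z)=\sum_{m\ge0}\frac{(a,q\sqrt a,-q\sqrt a,a_1,\dots,a_{r-2};q)_m}{(q,\sqrt a,-\sqrt a,qa/a_1,\dots,qa/a_{r-2};q)_m}z^m,$$ where $\sqrt a$ is a fixed square root of $a$ (so $\frac{(q\sqrt a,-q\sqrt a;q)_m}{(\sqrt a,-\sqrt a;q)_m}=\frac{1-aq^{2m}}{1-a}$). Here it terminates because $q^{-M}$ and $q^{-N}$ are among the parameters: all terms with $m>\min(M,N)$ are zero. *)

theory Defs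
  imports Complex_Main
begin

definition qpoch :: "complex \<Rightarrow> complex \<Rightarrow> nat \<Rightarrow> complex" where
  "qpoch x q n = (\<Prod>j<n. 1 - x * q ^ j)"

definition qpochs :: "complex list \<Rightarrow> complex \<Rightarrow> nat \<Rightarrow> complex" where
  "qpochs xs q n = (\<Prod>x\<leftarrow>xs. qpoch x q n)"

(* The fixed square root of a is the principal one; the choice is immaterial, since
   the two roots enter symmetrically. *)

definition vwp_num :: "complex \<Rightarrow> complex list \<Rightarrow> complex \<Rightarrow> nat \<Rightarrow> complex" where
  "vwp_num a as q m = qpochs ([a, q * csqrt a, - q * csqrt a] @ as) q m"

definition vwp_den :: "complex \<Rightarrow> complex list \<Rightarrow> complex \<Rightarrow> nat \<Rightarrow> complex" where
  "vwp_den a as q m = qpochs ([q, csqrt a, - csqrt a] @ map (\<lambda>x. q * a / x) as) q m"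

(* The series (r+1)W(r)(a; as; q, z), where r = length as + 2. *)

definition vwp_W :: "complex \<Rightarrow> complex list \<Rightarrow> complex \<Rightarrow> complex \<Rightarrow> complex" where
  "vwp_W a as q z = (\<Sum>m. vwp_num a as q m / vwp_den a as q m * z ^ m)"

end

theory Submission
  imports Defs
begin

text \<open>
  By the terminating ${}_6W_5$ summation, $(qa/d)_{n+l}/(qa)_{n+l}$ is, up to factors depending
  on $n$ only or on $l$ only, a very-well-poised sum over $m$ in which $n$ and $l$ are separated:
  they enter only through the Bailey kernels $1/((q)_{n-m}(qa)_{n+m})$ and
  $1/((q)_{l-m}(qa)_{l+m})$. After interchanging the sums, both inner sums are
  evaluated by the $q$-Pfaff--Saalschuetz summation. Both summations follow by induction on the
  terminating index: the difference of consecutive sums (suitably scaled) is a multiple of the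
  same sum with shifted parameters.
\<close>

section \<open>Shifted factorials: splitting, non-vanishing and reversal\<close>

lemma qpoch_0 [simp]: "qpoch x q 0 = 1"
  by (simp add: qpoch_def)

lemma qpoch_Suc: "qpoch x q (Suc n) = qpoch x q n * (1 - x * q ^ n)"
  by (simp add: qpoch_def)

lemma qpoch_add: "qpoch x q (m + n) = qpoch x q m * qpoch (x * q ^ m) q n"
  by (induction n) (simp_all add: qpoch_Suc power_add mult.assoc)

lemma qpoch_Suc_left: "qpoch x q (Suc n) = (1 - x) * qpoch (x * q) q n"
  using qpoch_add[of x q 1 n] by (simp add: qpoch_Suc)

lemma qpoch_nonzero_mono:
  assumes "qpoch x q n \<noteq> 0" "m \<le> n"
  shows "qpoch x q m \<noteq> 0"
  using assms qpoch_add[of x q m "n - m"] by auto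

lemma qpoch_q_nonzero:
  assumes "norm q < 1"
  shows "qpoch q q n \<noteq> 0"
proof -
  have "norm (q * q ^ j) < 1" for j
    using power_Suc_less_one[of "norm q" j] assms
    by (cases "q = 0") (simp_all add: norm_mult norm_power)
  then have "q * q ^ j \<noteq> 1" for j
    by (metis less_irrefl norm_one)
  then show ?thesis
    by (auto simp: qpoch_def)
qed

text \<open>The factor $1-q^{1+n-M}/E$ is a multiple of $1-Eq^{M-n-1}$, so each induction step moves
  one factor from one factorial to the other. The case $E=q$ describes $(q^{-M})_n$. The product of
  the $-q^{j-M}$ stays unevaluated because it cancels in a quotient of two reversals.\<close>

lemma qpoch_reverse:
  assumes "q \<noteq> 0" "E \<noteq> 0" "n \<le> M"
  shows "qpoch (q / (E * q ^ M)) q n * qpoch E q (M - n) =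
         qpoch E q M * (q / E) ^ n * (\<Prod>j<n. - (q ^ j / q ^ M))"
  using assms(3)
proof (induction n)
  case 0
  then show ?case by simp
next
  case (Suc n)
  define k where "k = M - Suc n"
  have k: "M - n = Suc k" "M = Suc (n + k)" using Suc.prems by (auto simp: k_def)
  have X: "1 - q / (E * q ^ M) * q ^ n = (q / E) * (- (q ^ n / q ^ M)) * (1 - E * q ^ k)"
    using assms(1,2) by (simp add: k(2) field_simps power_add)
  have "qpoch (q / (E * q ^ M)) q (Suc n) * qpoch E q k =
        (qpoch (q / (E * q ^ M)) q n * qpoch E q (Suc k)) * ((q / E) * (- (q ^ n / q ^ M)))"
    unfolding qpoch_Suc X by (simp only: mult_ac)
  also have "\<dots> = qpoch E q M * (q / E) ^ Suc n * (\<Prod>j<Suc n. - (q ^ j / q ^ M))"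
    using Suc by (simp add: k(1) mult_ac)
  finally show ?case by (simp only: k_def)
qed

section \<open>The q-Pfaff--Saalschuetz summation\<close>

text \<open>The factors $(q^{-n})_k/(q^{1-n}/E)_k$, $E = C/(AB)$, are written by reversal as
  $(E)_{n-k}/(q)_{n-k}$, so that no genericity condition on $E$ is needed in the induction.\<close>

lemma q_Pfaff_Saalschuetz:
  assumes q: "q \<noteq> 0" "norm q < 1"
    and "A \<noteq> 0" "B \<noteq> 0" "qpoch C q n \<noteq> 0"
  shows "(\<Sum>k\<le>n. qpoch A q k * qpoch B q k * qpoch (C / (A * B)) q (n - k) * (C / (A * B)) ^ k
            / (qpoch q q k * qpoch q q (n - k) * qpoch C q k)) =
         qpoch (C / A) q n * qpoch (C / B) q n / (qpoch q q n * qpoch C q n)"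
  using assms(3-)
proof (induction n arbitrary: A B C)
  case 0
  then show ?case by simp
next
  case (Suc n)
  note nz = qpoch_q_nonzero[OF q(2)]
  define E where "E = C / (A * B)"
  define t where "t n k = qpoch A q k * qpoch B q k * qpoch E q (n - k) * E ^ k
            / (qpoch q q k * qpoch q q (n - k) * qpoch C q k)" for n k
  define t' where "t' k = qpoch (A*q) q k * qpoch (B*q) q k * qpoch (E/q) q (n - k) * (E/q) ^ k
            / (qpoch q q k * qpoch q q (n - k) * qpoch (C*q) q k)" for k
  have Cn: "qpoch C q n \<noteq> 0" and Cq: "qpoch (C*q) q n \<noteq> 0"
    using Suc.prems(3) qpoch_Suc[of C q n] qpoch_Suc_left[of C q n] by auto
  \<comment> \<open>Multiplying \<open>A\<close>, \<open>B\<close> and \<open>C\<close> by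
    \<open>q\<close> turns \<open>E\<close> into \<open>E / q\<close> and fixes \<open>C / A\<close>
    and \<open>C / B\<close>, so the closed forms of the two sums to be combined differ only in
    their denominators.\<close>
  have E': "C * q / (A * q * (B * q)) = E / q" and CA: "C * q / (A * q) = C / A"
     and CB: "C * q / (B * q) = C / B"
    using q(1) by (simp_all add: E_def)
  have IH: "(\<Sum>k\<le>n. t n k) = qpoch (C / A) q n * qpoch (C / B) q n / (qpoch q q n * qpoch C q n)"
    using Suc.IH[of A B C] Suc.prems Cn by (simp add: t_def E_def)
  have IH': "(\<Sum>k\<le>n. t' k) =
      qpoch (C / A) q n * qpoch (C / B) q n / (qpoch q q n * qpoch (C*q) q n)"
    using Suc.IH[of "A*q" "B*q" "C*q"] Suc.prems Cq q(1) unfolding E' CA CB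
    by (simp add: t'_def)
  define g where "g = E * q ^ n * (1 - A) * (1 - B) / (1 - C)"
  \<comment> \<open>The guard \<open>k < n\<close> matters: at \<open>k = n\<close> truncated
    subtraction gives \<open>t n (Suc n)\<close> a possibly nonzero value, where the recurrence
    needs 0.\<close>
  have step: "(1 - q ^ Suc n) * t (Suc n) (Suc k) =
       (if k < n then (1 - E * q ^ n) * t n (Suc k) else 0) + g * t' k" if "k \<le> n" for k
  proof (cases "k < n")
    case True
    define p where "p = n - Suc k"
    have n: "n = Suc (p + k)" using True by (simp add: p_def)
    have i: "n - k = Suc p" "Suc n - Suc k = Suc p" "n - Suc k = p" using n by auto
    have p1: "1 - q * q ^ p \<noteq> 0" "1 - q * q ^ k \<noteq> 0"
      using nz[of "Suc p"] nz[of "Suc k"] by (simp_all add: qpoch_Suc)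
    have Eq: "qpoch (E / q) q (Suc p) = (1 - E / q) * qpoch E q p"
      using q(1) by (simp add: qpoch_Suc_left)
    have s: "t (Suc n) (Suc k) = (1-A)*(1-B)/(1-C) * E^Suc k / ((1 - q*q^k) * (1-q*q^p))
             * (1 - E*q^p) * (qpoch (A*q) q k * qpoch (B*q) q k * qpoch E q p
             / (qpoch q q k * qpoch q q p * qpoch (C*q) q k))"
      unfolding t_def i qpoch_Suc_left[of A] qpoch_Suc_left[of B] qpoch_Suc_left[of C]
        qpoch_Suc[of q] qpoch_Suc[of E]
      by (simp add: mult_ac)
    have s1: "t n (Suc k) = (1-A)*(1-B)/(1-C) * E^Suc k / (1 - q*q^k)
             * (qpoch (A*q) q k * qpoch (B*q) q k * qpoch E q p
             / (qpoch q q k * qpoch q q p * qpoch (C*q) q k))"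
      unfolding t_def i qpoch_Suc_left[of A] qpoch_Suc_left[of B] qpoch_Suc_left[of C]
        qpoch_Suc[of q] qpoch_Suc[of E]
      by (simp add: mult_ac)
    have s2: "t' k = (E/q)^k * (1 - E/q) / (1-q*q^p)
             * (qpoch (A*q) q k * qpoch (B*q) q k * qpoch E q p
             / (qpoch q q k * qpoch q q p * qpoch (C*q) q k))"
      unfolding t'_def i Eq qpoch_Suc[of q] by (simp add: mult_ac)
    define T where "T = qpoch (A*q) q k * qpoch (B*q) q k * qpoch E q p
             / (qpoch q q k * qpoch q q p * qpoch (C*q) q k)"
    define G where "G = (1-A)*(1-B)/(1-C)"
    have gG: "g = E * q^n * G" by (simp add: g_def G_def)
    \<comment> \<open>Apart from the common factor \<open>G * E^Suc k * T\<close>, the recurrence is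
      a rational identity in \<open>E\<close>, \<open>P\<close>, \<open>Q\<close> and
      \<open>q\<close>, since $q^n=qPQ$.\<close>
    define Q P where "Q = q ^ k" and "P = q ^ p"
    have Q0: "Q \<noteq> 0" using q by (simp add: Q_def)
    have qn: "q ^ n = q * P * Q" by (simp add: n Q_def P_def power_add)
    have p2: "1 - q * P \<noteq> 0" "1 - q * Q \<noteq> 0" using p1 by (simp_all add: Q_def P_def)
    have "(1 - q * (q * P * Q)) * (1 - E * P) / ((1 - q * Q) * (1 - q * P)) =
          (1 - E * (q * P * Q)) / (1 - q * Q) + (q * P) * (1 - E / q) / (1 - q * P)"
      using p2 q(1) by (simp add: divide_simps) (simp add: algebra_simps)
    then have "G * E^Suc k * T * ((1 - q * (q * P * Q)) * (1 - E * P) / ((1 - q * Q) * (1 - q * P))) =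
       G * E^Suc k * T * ((1 - E * (q * P * Q)) / (1 - q * Q) + (q * P) * (1 - E / q) / (1 - q * P))"
      by simp
    moreover have "g * t' k = G * E^Suc k * T * ((q * P) * (1 - E / q) / (1 - q * P))"
      unfolding gG s2 T_def[symmetric] qn power_divide Q_def[symmetric] P_def[symmetric]
      using Q0 by (simp add: mult_ac)
    ultimately show ?thesis
      unfolding s s1 T_def[symmetric] G_def[symmetric] P_def[symmetric] Q_def[symmetric] power_Suc qn
      using True by (simp add: distrib_left mult_ac)
  next
    case False
    with that have k: "k = n" by simp
    have p1: "1 - q * q ^ n \<noteq> 0"
      using nz[of "Suc n"] by (simp add: qpoch_Suc)
    have t1: "t (Suc n) (Suc k) = (1-A)*(1-B)/(1-C) * E^Suc n / (1 - q*q^n)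
             * (qpoch (A*q) q n * qpoch (B*q) q n / (qpoch q q n * qpoch (C*q) q n))"
      unfolding t_def k qpoch_Suc_left[of A] qpoch_Suc_left[of B] qpoch_Suc_left[of C] qpoch_Suc[of q]
      by (simp add: mult_ac)
    have t2: "t' k = (E/q)^n * (qpoch (A*q) q n * qpoch (B*q) q n / (qpoch q q n * qpoch (C*q) q n))"
      unfolding t'_def k by simp
    show ?thesis unfolding t1 t2 g_def using k p1 q(1) by (simp add: power_divide)
  qed
  have step0: "(1 - q ^ Suc n) * t (Suc n) 0 = (1 - E * q ^ n) * t n 0"
    using nz[of "Suc n"] nz[of n] by (simp add: t_def qpoch_Suc)
  have tn: "(\<Sum>k\<le>n. t n k) = t n 0 + (\<Sum>k<n. t n (Suc k))"
    by (metis lessThan_Suc_atMost sum.lessThan_Suc_shift)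
  have "(1 - q ^ Suc n) * (\<Sum>k\<le>Suc n. t (Suc n) k) =
        (1 - q ^ Suc n) * t (Suc n) 0 + (\<Sum>k\<le>n. (1 - q ^ Suc n) * t (Suc n) (Suc k))"
    by (subst sum.atMost_Suc_shift) (simp only: distrib_left sum_distrib_left)
  also have "(\<Sum>k\<le>n. (1 - q ^ Suc n) * t (Suc n) (Suc k)) =
     (\<Sum>k\<le>n. (if k < n then (1 - E * q ^ n) * t n (Suc k) else 0) + g * t' k)"
    by (intro sum.cong refl step) auto
  also have "\<dots> = (\<Sum>k<n. (1 - E * q ^ n) * t n (Suc k)) + g * (\<Sum>k\<le>n. t' k)"
    by (simp add: sum.distrib sum_distrib_left distrib_left lessThan_Suc_atMost[symmetric])
  also have "(1 - q ^ Suc n) * t (Suc n) 0 + \<dots> =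
      (1 - E * q ^ n) * (\<Sum>k\<le>n. t n k) + g * (\<Sum>k\<le>n. t' k)"
    unfolding step0 tn by (simp add: distrib_left sum_distrib_left)
  also have "\<dots> = (1 - q ^ Suc n) *
      (qpoch (C / A) q (Suc n) * qpoch (C / B) q (Suc n) / (qpoch q q (Suc n) * qpoch C q (Suc n)))"
  proof -
    define T where "T = qpoch (C / A) q n * qpoch (C / B) q n / qpoch q q n"
    have Cn1: "1 - C * q ^ n \<noteq> 0"
      using Suc.prems(3) by (simp add: qpoch_Suc)
    then have c: "qpoch C q n = (1 - C) * qpoch (C*q) q n / (1 - C * q ^ n)"
      by (simp add: eq_divide_eq flip: qpoch_Suc qpoch_Suc_left)
    have p1: "1 - q * q ^ n \<noteq> 0" using nz[of "Suc n"] by (simp add: qpoch_Suc)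
    \<comment> \<open>Because $E=C/(AB)$, the closed form obeys the recurrence just found for the
      sum.\<close>
    have key: "(1 - C / A * q ^ n) * (1 - C / B * q ^ n) =
          (1 - E * q ^ n) * (1 - C * q ^ n) + E * q ^ n * (1 - A) * (1 - B)"
      using Suc.prems(1,2) by (simp add: E_def divide_simps) (simp add: algebra_simps)
    have r: "(1 - q ^ Suc n) *
      (qpoch (C / A) q (Suc n) * qpoch (C / B) q (Suc n) / (qpoch q q (Suc n) * qpoch C q (Suc n)))
      = T * ((1 - C / A * q ^ n) * (1 - C / B * q ^ n)) / ((1 - C) * qpoch (C*q) q n)"
      unfolding qpoch_Suc_left[of C] qpoch_Suc[of "C / A"] qpoch_Suc[of "C / B"] qpoch_Suc[of q] T_def
      using p1 by (simp add: mult_ac)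
    have l: "(1 - E * q ^ n) * (\<Sum>k\<le>n. t n k) = T * (1 - E * q ^ n) * (1 - C * q ^ n) / ((1 - C) * qpoch (C*q) q n)"
      unfolding IH c T_def by (simp add: mult_ac)
    have l': "g * (\<Sum>k\<le>n. t' k) = T * (E * q ^ n * (1 - A) * (1 - B)) / ((1 - C) * qpoch (C*q) q n)"
      unfolding IH' g_def T_def by (simp add: mult_ac)
    show ?thesis unfolding r key l l' by (simp add: add_divide_distrib distrib_left mult_ac)
  qed
  finally have eq: "(1 - q ^ Suc n) * (\<Sum>k\<le>Suc n. t (Suc n) k) = \<dots>" .
  have "1 - q ^ Suc n \<noteq> 0" using nz[of "Suc n"] by (simp add: qpoch_Suc)
  from mult_left_cancel[THEN iffD1, OF this eq] show ?case by (simp only: t_def E_def)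
qed

section \<open>The very-well-poised factor\<close>

text \<open>$\frac{(a,q\sqrt a,-q\sqrt a)_m}{(\sqrt a,-\sqrt a)_m} = \frac{(a)_m(1-aq^{2m})}{1-a}$ with the factor
  $1-a$ cancelled, so that $a = 1$ is harmless.\<close>

definition vwp_coeff :: "complex \<Rightarrow> complex \<Rightarrow> nat \<Rightarrow> complex" where
  "vwp_coeff a q m = (case m of 0 \<Rightarrow> 1 | Suc j \<Rightarrow> qpoch (a * q) q j * (1 - a * q ^ (2 * m)))"

lemma vwp_coeff_0 [simp]: "vwp_coeff a q 0 = 1"
  by (simp add: vwp_coeff_def)

text \<open>The form without division remains true where $1-aq^{2m}$ vanishes, for instance at
  $m=0$, $a=1$.\<close>

lemma vwp_coeff_step:
  "(1 - a * q ^ (2 * m)) * vwp_coeff a q (Suc m) =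
   (1 - a * q ^ m) * (1 - a * q ^ (2 * Suc m)) * vwp_coeff a q m"
  by (cases m) (simp_all add: vwp_coeff_def qpoch_Suc mult_ac)

text \<open>Lowering the index by one replaces $a$ by $aq^2$, since $1-aq^{2(j+1)}=1-(aq^2)q^{2j}$.
  The prefactor lengthens $(aq)_j$ to $(aq)_{j+1}$, whose first two factors split off when
  $j>0$.\<close>

lemma vwp_coeff_shift:
  "(1 - a * q ^ Suc j) * vwp_coeff a q (Suc j) =
   (1 - a * q) * (1 - a * q ^ 2) * vwp_coeff (a * q ^ 2) q j"
proof (cases j)
  case 0
  then show ?thesis by (simp add: vwp_coeff_def)
next
  case (Suc i)
  have "(1 - a * q ^ Suc j) * vwp_coeff a q (Suc j) = qpoch (a * q) q (Suc j) * (1 - a * q ^ (2 * Suc j))"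
    by (simp add: vwp_coeff_def qpoch_Suc mult_ac)
  also have "\<dots> = (1 - a * q) * (1 - a * q ^ 2) * (qpoch (a * q ^ 2 * q) q i * (1 - a * q ^ (2 * Suc j)))"
    unfolding Suc by (simp add: qpoch_Suc_left power2_eq_square mult_ac)
  finally show ?thesis by (simp add: vwp_coeff_def Suc power2_eq_square mult_ac)
qed

text \<open>The factors of $s$ and $-s$ pair up to $1-aq^{2m}$, which leaves the recurrence
  \<open>vwp_coeff_step\<close>. The hypothesis on the denominators is what allows dividing by
  $1-aq^{2m}$ there.\<close>

lemma vwp_coeff_eq:
  assumes "s ^ 2 = a" "qpoch s q m * qpoch (- s) q m \<noteq> 0"
  shows "qpoch a q m * qpoch (q * s) q m * qpoch (- q * s) q m
         / (qpoch s q m * qpoch (- s) q m) = vwp_coeff a q m"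
  using assms(2)
proof (induction m)
  case 0
  then show ?case by simp
next
  case (Suc m)
  have e: "q ^ (2 * m) = q ^ m * q ^ m" "q ^ (2 * Suc m) = q * q * (q ^ m * q ^ m)"
    by (simp_all add: mult_2 power_add)
  have f: "(1 - s * q ^ m) * (1 - (-s) * q ^ m) = 1 - a * q ^ (2 * m)"
    unfolding e assms(1)[symmetric] by (simp add: algebra_simps power2_eq_square)
  have f': "(1 - q * s * q ^ m) * (1 - (- q * s) * q ^ m) = 1 - a * q ^ (2 * Suc m)"
    unfolding e assms(1)[symmetric] by (simp add: algebra_simps power2_eq_square)
  have nz: "1 - a * q ^ (2 * m) \<noteq> 0" "qpoch s q m * qpoch (- s) q m \<noteq> 0"
    using Suc.prems unfolding f[symmetric] by (auto simp: qpoch_Suc)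
  have "qpoch a q (Suc m) * qpoch (q * s) q (Suc m) * qpoch (- q * s) q (Suc m)
         / (qpoch s q (Suc m) * qpoch (- s) q (Suc m)) =
        (qpoch a q m * qpoch (q * s) q m * qpoch (- q * s) q m / (qpoch s q m * qpoch (- s) q m))
        * ((1 - a * q ^ m) * ((1 - q * s * q ^ m) * (1 - (- q * s) * q ^ m)))
          / ((1 - s * q ^ m) * (1 - (-s) * q ^ m))"
    unfolding qpoch_Suc by (simp add: mult_ac)
  also have "\<dots> = vwp_coeff a q (Suc m)"
    unfolding f f' Suc.IH[OF nz(2)] using vwp_coeff_step[of a q m] nz(1)
    by (simp add: field_simps)
  finally show ?case .
qed

section \<open>The Bailey kernel and the terminating 6W5 summation\<close>

text \<open>The zero branch is the convention that $1/(q;q)_{n-m}$ vanishes for $m>n$, which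
  truncated subtraction would lose. It allows ranges of summation over \<open>m\<close> that do not
  depend on \<open>n\<close>.\<close>

definition bailey_kernel :: "complex \<Rightarrow> complex \<Rightarrow> nat \<Rightarrow> nat \<Rightarrow> complex" where
  "bailey_kernel a q n m =
     (if m \<le> n then 1 / (qpoch q q (n - m) * qpoch (a * q) q (n + m)) else 0)"

text \<open>With $k=n+1-m$, the product $(1-q^{n+1})(1-aq^{n+1})$ equals
  $(1-q^k)(1-aq^{n+1+m})+q^k(1-q^m)(1-aq^m)$. The first summand lowers the kernel from $n+1$ to $n$;
  the second vanishes at $m=0$, so a sum over it can be reindexed.\<close>

lemma bailey_kernel_step:
  assumes "norm q < 1" "m \<le> Suc n \<Longrightarrow> qpoch (a * q) q (Suc n + m) \<noteq> 0"
  shows "(1 - q ^ Suc n) * (1 - a * q ^ Suc n) * bailey_kernel a q (Suc n) m =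
         bailey_kernel a q n m
         + q ^ (Suc n - m) * (1 - q ^ m) * (1 - a * q ^ m) * bailey_kernel a q (Suc n) m"
proof (cases "m \<le> Suc n")
  case True
  define k where "k = Suc n - m"
  have k: "Suc n = k + m" using True by (simp add: k_def)
  have a: "(1 - q ^ Suc n) * (1 - a * q ^ Suc n) =
      (1 - q ^ k) * (1 - a * q ^ (Suc n + m)) + q ^ k * (1 - q ^ m) * (1 - a * q ^ m)"
    unfolding k by (simp add: power_add algebra_simps)
  have b: "(1 - q ^ k) * (1 - a * q ^ (Suc n + m)) * bailey_kernel a q (Suc n) m = bailey_kernel a q n m"
  proof (cases k)
    case 0
    then show ?thesis using k by (simp add: bailey_kernel_def)
  next
    case (Suc j)
    have j: "Suc n - m = Suc j" "n - m = j" "m \<le> n" using Suc k by auto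
    have "qpoch (a * q) q (Suc (n + m)) \<noteq> 0" "qpoch q q (Suc j) \<noteq> 0"
      using assms(2) True qpoch_q_nonzero[OF assms(1)] by auto
    then have "1 - a * q * q ^ (n + m) \<noteq> 0" "1 - q * q ^ j \<noteq> 0" by (auto simp: qpoch_Suc)
    then show ?thesis using j True
      by (simp add: bailey_kernel_def Suc qpoch_Suc mult_ac)
  qed
  show ?thesis unfolding a k_def[symmetric] distrib_right b by simp
next
  case False
  then show ?thesis by (simp add: bailey_kernel_def)
qed

text \<open>Companion of \<open>vwp_coeff_shift\<close>: the first two factors of $(aq)_{n+j+2}$
  split off, so that lowering both indices again replaces $a$ by $aq^2$.\<close>

lemma bailey_kernel_shift:
  "bailey_kernel a q (Suc n) (Suc j) = bailey_kernel (a * q ^ 2) q n j / ((1 - a * q) * (1 - a * q ^ 2))"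
proof -
  have "qpoch (a * q) q (Suc n + Suc j) = (1 - a * q) * (1 - a * q ^ 2) * qpoch (a * q ^ 2 * q) q (n + j)"
    by (simp add: qpoch_Suc_left power2_eq_square mult_ac)
  then show ?thesis by (simp add: bailey_kernel_def)
qed

text \<open>The terminating ${}_6W_5$ summation, with the two terminating parameters
  $q^{-n}$ and $q^{-l}$ absorbed in the two kernels; here $f = aq/d$.\<close>

lemma bailey_kernel_sum:
  assumes q: "norm q < 1"
    and "f * d = a * q" "qpoch (a * q) q (n + l) \<noteq> 0" "qpoch f q n \<noteq> 0" "qpoch f q l \<noteq> 0"
  shows "(\<Sum>m\<le>l. vwp_coeff a q m * qpoch d q m * f ^ m * q ^ (m * (m - 1))
            / (qpoch q q m * qpoch f q m) * bailey_kernel a q n m * bailey_kernel a q l m) =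
         qpoch f q (n + l)
         / (qpoch (a * q) q (n + l) * qpoch f q n * qpoch f q l * qpoch q q n * qpoch q q l)"
  using assms(2-)
proof (induction n arbitrary: l a d f)
  case 0
  have "(\<Sum>m\<le>l. vwp_coeff a q m * qpoch d q m * f ^ m * q ^ (m * (m - 1))
            / (qpoch q q m * qpoch f q m) * bailey_kernel a q 0 m * bailey_kernel a q l m) =
        (\<Sum>m\<in>{0}. vwp_coeff a q m * qpoch d q m * f ^ m * q ^ (m * (m - 1))
            / (qpoch q q m * qpoch f q m) * bailey_kernel a q 0 m * bailey_kernel a q l m)"
    by (rule sum.mono_neutral_right) (auto simp: bailey_kernel_def)
  then show ?case using 0 by (simp add: bailey_kernel_def)
next
  case (Suc n)
  note nz = qpoch_q_nonzero[OF q]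
  have n1: "1 - q * q ^ n \<noteq> 0" using nz[of "Suc n"] by (simp add: qpoch_Suc)
  show ?case
  proof (cases l)
    case 0
    then show ?thesis using Suc.prems by (simp add: bailey_kernel_def)
  next
    case (Suc p)
    define c where "c a d f m = vwp_coeff a q m * qpoch d q m * f ^ m * q ^ (m * (m - 1))
            / (qpoch q q m * qpoch f q m)" for a d f m
    have AN: "qpoch (a * q) q (Suc (n + l)) \<noteq> 0" using Suc.prems(2) by simp
    have aq: "1 - a * q \<noteq> 0" "1 - a * q ^ 2 \<noteq> 0" "qpoch (a * q ^ 2 * q) q (n + p) \<noteq> 0"
      using AN by (auto simp: Suc qpoch_Suc_left power2_eq_square mult_ac)
    have f1: "1 - f \<noteq> 0" "qpoch (f * q) q n \<noteq> 0" "qpoch (f * q) q p \<noteq> 0"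
      using Suc.prems(3,4) by (auto simp: Suc qpoch_Suc_left)
    have IH: "(\<Sum>m\<le>l. c a d f m * bailey_kernel a q n m * bailey_kernel a q l m) =
         qpoch f q (n + l)
         / (qpoch (a * q) q (n + l) * qpoch f q n * qpoch f q l * qpoch q q n * qpoch q q l)"
      unfolding c_def using Suc.prems AN by (intro Suc.IH) (auto simp: qpoch_Suc)
    \<comment> \<open>Passing from $(a,d,f)$ to $(aq^2,dq,fq)$ preserves the relation $fd=aq$, while
      \<open>l\<close> drops to \<open>p\<close>; hence the induction leaves all four
      arbitrary.\<close>
    have IH': "(\<Sum>m\<le>p. c (a*q^2) (d*q) (f*q) m * bailey_kernel (a*q^2) q n m * bailey_kernel (a*q^2) q p m) =
         qpoch (f*q) q (n + p)
         / (qpoch (a * q^2 * q) q (n + p) * qpoch (f*q) q n * qpoch (f*q) q p * qpoch q q n * qpoch q q p)"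
      unfolding c_def using Suc.prems(1) aq(3) f1(2,3)
      by (intro Suc.IH) (auto simp: power2_eq_square mult_ac)
    define g where "g = f * q ^ n * (1 - d) / ((1 - f) * (1 - a * q) * (1 - a * q ^ 2))"
    \<comment> \<open>At $m=j+1$ the factor $1-q^m$ cancels the last factor of $(q)_m$, and $1-aq^m$
      is the prefactor that \<open>vwp_coeff_shift\<close> requires.\<close>
    have c_step: "q ^ (Suc n - Suc j) * (1 - q ^ Suc j) * (1 - a * q ^ Suc j) * c a d f (Suc j) =
        f * q ^ n * (1 - d) / (1 - f) * (1 - a * q) * (1 - a * q ^ 2) * c (a*q^2) (d*q) (f*q) j"
      if "j \<le> n" for j
    proof -
      have j1: "1 - q ^ Suc j \<noteq> 0" using nz[of "Suc j"] by (simp add: qpoch_Suc)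
      have "q ^ (n - j) * q ^ (Suc j * j) = q ^ n * q ^ j * q ^ (j * (j - 1))"
      proof -
        \<comment> \<open>The bound $j<=n$ makes the subtraction genuine. The resulting $q^j$ is
          absorbed by turning $f^j$ into $(fq)^j$.\<close>
        have "(n - j) + Suc j * j = n + j + j * (j - 1)" using that by (cases j) auto
        then show ?thesis by (metis power_add)
      qed
      then have pw: "q ^ (n - j) * (f ^ Suc j * q ^ (Suc j * j)) = f * q ^ n * ((f * q) ^ j * q ^ (j * (j - 1)))"
        by (simp add: power_mult_distrib mult_ac)
      have "q ^ (Suc n - Suc j) * (1 - q ^ Suc j) * (1 - a * q ^ Suc j) * c a d f (Suc j) =
         ((1 - a * q ^ Suc j) * vwp_coeff a q (Suc j)) * (1 - d) * qpoch (d * q) q j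
          * (q ^ (n - j) * (f ^ Suc j * q ^ (Suc j * j))) * (1 - q ^ Suc j)
          / (qpoch q q j * (1 - q ^ Suc j) * ((1 - f) * qpoch (f * q) q j))"
        unfolding c_def qpoch_Suc_left[of d] qpoch_Suc_left[of f] qpoch_Suc[of q]
        by (simp add: mult_ac)
      also have "\<dots> = f * q ^ n * (1 - d) / (1 - f) * (1 - a * q) * (1 - a * q ^ 2) * c (a*q^2) (d*q) (f*q) j"
        unfolding vwp_coeff_shift pw c_def using j1 by (simp add: mult_ac)
      finally show ?thesis .
    qed
    have step: "q ^ (Suc n - Suc j) * (1 - q ^ Suc j) * (1 - a * q ^ Suc j) * c a d f (Suc j)
            * bailey_kernel a q (Suc n) (Suc j) * bailey_kernel a q l (Suc j) =
          g * (c (a*q^2) (d*q) (f*q) j * bailey_kernel (a*q^2) q n j * bailey_kernel (a*q^2) q p j)" for j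
    proof (cases "j \<le> n")
      case True
      show ?thesis
        unfolding c_step[OF True] Suc bailey_kernel_shift g_def using aq f1(1)
        by (simp add: mult_ac)
    next
      case False
      then show ?thesis by (simp add: bailey_kernel_def)
    qed
    have "(1 - q ^ Suc n) * (1 - a * q ^ Suc n)
            * (\<Sum>m\<le>l. c a d f m * bailey_kernel a q (Suc n) m * bailey_kernel a q l m) =
          (\<Sum>m\<le>l. c a d f m * bailey_kernel a q l m
             * ((1 - q ^ Suc n) * (1 - a * q ^ Suc n) * bailey_kernel a q (Suc n) m))"
      by (simp add: sum_distrib_left mult_ac)
    also have "\<dots> = (\<Sum>m\<le>l. c a d f m * bailey_kernel a q l m
             * (bailey_kernel a q n m
         + q ^ (Suc n - m) * (1 - q ^ m) * (1 - a * q ^ m) * bailey_kernel a q (Suc n) m))"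
      using Suc.prems(2) q qpoch_nonzero_mono[of "a*q" q "Suc n + l"]
      by (intro sum.cong refl, subst bailey_kernel_step) auto
    also have "\<dots> = (\<Sum>m\<le>l. c a d f m * bailey_kernel a q n m * bailey_kernel a q l m)
        + (\<Sum>m\<le>l. q ^ (Suc n - m) * (1 - q ^ m) * (1 - a * q ^ m) * c a d f m
            * bailey_kernel a q (Suc n) m * bailey_kernel a q l m)"
      by (simp add: sum.distrib distrib_left mult_ac)
    \<comment> \<open>The factor $1-q^m$ removes the term $m=0$; after reindexing, the rest is the
      shifted sum of \<open>IH'\<close>.\<close>
    also have "(\<Sum>m\<le>l. q ^ (Suc n - m) * (1 - q ^ m) * (1 - a * q ^ m) * c a d f m
            * bailey_kernel a q (Suc n) m * bailey_kernel a q l m) =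
         g * (\<Sum>m\<le>p. c (a*q^2) (d*q) (f*q) m * bailey_kernel (a*q^2) q n m * bailey_kernel (a*q^2) q p m)"
      unfolding Suc sum.atMost_Suc_shift step[unfolded Suc] sum_distrib_left by simp
    also have "(\<Sum>m\<le>l. c a d f m * bailey_kernel a q n m * bailey_kernel a q l m) + \<dots> =
         (1 - q ^ Suc n) * (1 - a * q ^ Suc n) * (qpoch f q (Suc n + l)
         / (qpoch (a * q) q (Suc n + l) * qpoch f q (Suc n) * qpoch f q l * qpoch q q (Suc n) * qpoch q q l))"
    proof -
      define T where "T = qpoch f q (n + l)
         / (qpoch (a * q) q (Suc (n + l)) * qpoch f q (Suc n) * qpoch f q l * qpoch q q n * qpoch q q l)"
      have fn: "1 - f * q ^ n \<noteq> 0" and an: "1 - a * q * q ^ (n + l) \<noteq> 0"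
        using Suc.prems(3) AN by (auto simp: qpoch_Suc)
      have l1: "1 - q ^ l \<noteq> 0" using nz[of l] unfolding Suc by (simp add: qpoch_Suc)
      have e1: "qpoch f q (n + l)
         / (qpoch (a * q) q (n + l) * qpoch f q n * qpoch f q l * qpoch q q n * qpoch q q l)
         = T * ((1 - a * q * q ^ (n + l)) * (1 - f * q ^ n))"
        using fn an by (simp add: T_def qpoch_Suc)
      have e3: "(1 - q ^ Suc n) * (1 - a * q ^ Suc n) * (qpoch f q (Suc n + l)
         / (qpoch (a * q) q (Suc n + l) * qpoch f q (Suc n) * qpoch f q l * qpoch q q (Suc n) * qpoch q q l))
         = T * ((1 - f * q ^ (n + l)) * (1 - a * q ^ Suc n))"
        using n1 by (simp add: T_def qpoch_Suc mult_ac)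
      have h1: "qpoch f q (n + l) = (1 - f) * qpoch (f*q) q (n + p)"
        "qpoch f q l = (1 - f) * qpoch (f*q) q p"
        "qpoch q q l = qpoch q q p * (1 - q ^ l)"
        using qpoch_Suc[of q q p] by (simp_all add: Suc qpoch_Suc_left)
      have h2: "qpoch (a * q) q (Suc (n + l)) = (1 - a * q) * (1 - a * q^2) * qpoch (a * q^2 * q) q (n + p)"
        by (simp add: Suc qpoch_Suc_left power2_eq_square mult_ac)
      have e2: "g * (qpoch (f*q) q (n + p)
         / (qpoch (a * q^2 * q) q (n + p) * qpoch (f*q) q n * qpoch (f*q) q p * qpoch q q n * qpoch q q p))
         = T * (f * q ^ n * (1 - d) * (1 - q ^ l))"
        unfolding T_def h1 h2 qpoch_Suc_left[of f] g_def using l1 f1(1) by (simp add: mult_ac)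
      \<comment> \<open>The relation $fd=aq$ eliminates $d$, and a polynomial identity in $f$, $aq$,
        $q^n$ and $q^l$ remains.\<close>
      have fd: "f * q ^ n * (1 - d) = (f - a * q) * q ^ n"
        by (simp add: algebra_simps flip: Suc.prems(1))
      have "(1 - f * q ^ (n + l)) * (1 - a * q ^ Suc n) =
         (1 - a * q * q ^ (n + l)) * (1 - f * q ^ n) + f * q ^ n * (1 - d) * (1 - q ^ l)"
        unfolding fd by (simp add: algebra_simps power_add)
      then show ?thesis unfolding IH IH' e1 e2 e3 by (simp add: distrib_left)
    qed
    finally have eq: "(1 - q ^ Suc n) * (1 - a * q ^ Suc n)
            * (\<Sum>m\<le>l. c a d f m * bailey_kernel a q (Suc n) m * bailey_kernel a q l m) = \<dots>" .
    have "qpoch (a * q) q (Suc n) \<noteq> 0"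
      using AN qpoch_nonzero_mono[of "a*q" q "Suc (n+l)" "Suc n"] by simp
    then have "(1 - q ^ Suc n) * (1 - a * q ^ Suc n) \<noteq> 0"
      using n1 by (simp add: qpoch_Suc mult_ac)
    from mult_left_cancel[THEN iffD1, OF this eq] show ?thesis unfolding c_def .
  qed
qed

section \<open>The inner sums: a conjugate Bailey pair\<close>

text \<open>Only terms with $n>=m$ survive, and $n=m+k$ gives a q-Pfaff--Saalschuetz sum of length
  $M-m$ with parameters $bq^m$, $cq^m$, $aq^{2m+1}$. The reversal product is kept in the denominator
  so that \<open>prod_neg_powers\<close> can later merge two such evaluations.\<close>

lemma bailey_kernel_Saalschuetz:
  assumes q: "q \<noteq> 0" "norm q < 1" and nz: "a \<noteq> 0" "b \<noteq> 0" "c \<noteq> 0"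
    and m: "m \<le> M" and aq: "qpoch (q * a) q (M + m) \<noteq> 0" and E: "qpoch (q * a / (b * c)) q M \<noteq> 0"
    and den: "qpoch (q * a / b) q m \<noteq> 0" "qpoch (q * a / c) q m \<noteq> 0"
  shows "(\<Sum>n\<le>M. qpochs [b, c, q powi (- int M)] q n / qpoch (b * c * q powi (- int M) / a) q n
            * q ^ n * bailey_kernel a q n m) =
         qpochs [q * a / b, q * a / c] q M / qpochs [q * a, q * a / (b * c)] q M
         * (qpochs [b, c, q powi (- int M)] q m
            / qpochs [q * a / b, q * a / c, q * a / q powi (- int M)] q m)
         * ((q * a / (b * c)) ^ m / (\<Prod>j<m. - (q ^ j / q ^ M)))"
proof -
  note nzq = qpoch_q_nonzero[OF q(2)]
  define E where "E = q * a / (b * c)"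
  define s where "s m = (\<Prod>j<m. - (q ^ j / q ^ M))" for m
  have E0: "E \<noteq> 0" using q nz by (simp add: E_def)
  have EM: "qpoch E q M \<noteq> 0" using E by (simp add: E_def)
  have s0: "s k \<noteq> 0" for k using q by (simp add: s_def)
  have qM: "q powi (- int M) = 1 / q ^ M"
    by (simp add: power_int_minus field_simps)
  have bc: "b * c * q powi (- int M) / a = q / (E * q ^ M)"
    using q nz by (simp add: qM E_def)
  have rev1: "qpoch (q powi (- int M)) q k = qpoch q q M * s k / qpoch q q (M - k)" if "k \<le> M" for k
    using qpoch_reverse[OF q(1) q(1) that] q nzq[of "M - k"] by (simp add: qM s_def field_simps)
  have rev2: "qpoch (b * c * q powi (- int M) / a) q k = qpoch E q M * (q / E) ^ k * s k / qpoch E q (M - k)"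
    if "k \<le> M" for k
    using qpoch_reverse[OF q(1) E0 that] qpoch_nonzero_mono[OF EM, of "M - k"]
    unfolding bc by (simp add: s_def eq_divide_eq)
  \<comment> \<open>The reversal products \<open>s k\<close> cancel, and $q^k$ divided by $(q/E)^k$
    gives $E^k$; this is the form of the summand in \<open>q_Pfaff_Saalschuetz\<close>.\<close>
  have ratio: "qpochs [b, c, q powi (- int M)] q k / qpoch (b * c * q powi (- int M) / a) q k * q ^ k =
     qpoch q q M / qpoch E q M * (qpoch b q k * qpoch c q k * qpoch E q (M - k) * E ^ k / qpoch q q (M - k))"
    if "k \<le> M" for k
    unfolding qpochs_def rev2[OF that]
    using rev1[OF that] s0[of k] q E0 by (simp add: power_divide field_simps)
  define p where "p = M - m"
  have M: "M = m + p" using m by (simp add: p_def)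
  \<comment> \<open>Splitting the factorials at \<open>m\<close> produces these parameters; their
    quotient $C/(AB)$ is \<open>E\<close> for every \<open>m\<close>.\<close>
  define A B C where "A = b * q ^ m" and "B = c * q ^ m" and "C = a * q * q ^ (2 * m)"
  have AB: "A \<noteq> 0" "B \<noteq> 0" using nz q by (simp_all add: A_def B_def)
  have CE: "C / (A * B) = E" "C / A = q * a / b * q ^ m" "C / B = q * a / c * q ^ m"
    using nz q by (simp_all add: A_def B_def C_def E_def field_simps power_add mult_2 mult_2_right)
  have aC: "qpoch (a * q) q (2 * m + k) = qpoch (a * q) q (2 * m) * qpoch C q k" for k
    by (simp add: qpoch_add C_def)
  have Mm: "M + m = 2 * m + p" by (simp add: M)
  have aq': "qpoch (a * q) q (2 * m) \<noteq> 0" "qpoch C q p \<noteq> 0"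
    using aq aC[of p] unfolding Mm by (simp_all add: mult.commute)
  have "(\<Sum>n\<le>M. qpochs [b, c, q powi (- int M)] q n / qpoch (b * c * q powi (- int M) / a) q n
            * q ^ n * bailey_kernel a q n m) =
        (\<Sum>n\<le>M. qpoch q q M / qpoch E q M * (qpoch b q n * qpoch c q n * qpoch E q (M - n) * E ^ n
            / qpoch q q (M - n)) * bailey_kernel a q n m)"
    by (intro sum.cong refl) (simp only: ratio atMost_iff)
  also have "\<dots> = (\<Sum>n\<in>{0+m..p+m}. qpoch q q M / qpoch E q M * (qpoch b q n * qpoch c q n * qpoch E q (M - n) * E ^ n
            / qpoch q q (M - n)) * bailey_kernel a q n m)"
    by (rule sum.mono_neutral_right) (auto simp: M bailey_kernel_def)
  also have "\<dots> = (\<Sum>k\<le>p. qpoch q q M / qpoch E q M * (qpoch b q (m+k) * qpoch c q (m+k) * qpoch E q (p - k) * E ^ (m+k)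
            / qpoch q q (p - k)) * bailey_kernel a q (m+k) m)"
    unfolding sum.shift_bounds_cl_nat_ivl atMost_atLeast0 by (simp add: M add.commute)
  also have "\<dots> = (\<Sum>k\<le>p. (qpoch q q M / qpoch E q M * qpoch b q m * qpoch c q m * E ^ m / qpoch (a * q) q (2 * m)) *
      (qpoch A q k * qpoch B q k * qpoch E q (p - k) * E ^ k / (qpoch q q k * qpoch q q (p - k) * qpoch C q k)))"
  proof (rule sum.cong[OF refl])
    fix k
    have mk: "m + k + m = 2 * m + k" by simp
    have "bailey_kernel a q (m+k) m = 1 / (qpoch q q k * (qpoch (a * q) q (2 * m) * qpoch C q k))"
      unfolding bailey_kernel_def mk aC by simp
    then show "qpoch q q M / qpoch E q M * (qpoch b q (m+k) * qpoch c q (m+k) * qpoch E q (p - k) * E ^ (m+k)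
            / qpoch q q (p - k)) * bailey_kernel a q (m+k) m =
       (qpoch q q M / qpoch E q M * qpoch b q m * qpoch c q m * E ^ m / qpoch (a * q) q (2 * m)) *
      (qpoch A q k * qpoch B q k * qpoch E q (p - k) * E ^ k / (qpoch q q k * qpoch q q (p - k) * qpoch C q k))"
      by (simp add: qpoch_add power_add A_def B_def mult_ac)
  qed
  also have "\<dots> = (qpoch q q M / qpoch E q M * qpoch b q m * qpoch c q m * E ^ m / qpoch (a * q) q (2 * m)) *
      (qpoch (q * a / b * q ^ m) q p * qpoch (q * a / c * q ^ m) q p / (qpoch q q p * qpoch C q p))"
    using q_Pfaff_Saalschuetz[OF q AB aq'(2)] unfolding CE by (simp only: sum_distrib_left[symmetric])
  also have "\<dots> = qpochs [q * a / b, q * a / c] q M / qpochs [q * a, E] q M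
         * (qpochs [b, c, q powi (- int M)] q m
            / qpochs [q * a / b, q * a / c, q * a / q powi (- int M)] q m)
         * (E ^ m / s m)"
  proof -
    \<comment> \<open>Splitting $(aq)_{M+m}$ both at $M$ and at $2m$ converts the denominators left
      by the summation into $(qa)_M$ and $(qa/q^{-M})_m$.\<close>
    have aM: "qpoch (a * q) q M * qpoch (a * q * q ^ M) q m = qpoch (a * q) q (2 * m) * qpoch C q p"
      using aC[of p] qpoch_add[of "a * q" q M m] unfolding Mm[symmetric] by simp
    then have a0: "qpoch (a * q) q M \<noteq> 0" using aq' by auto
    have r: "qpoch (q * a / q powi (- int M)) q m = qpoch (a * q) q (2 * m) * qpoch C q p / qpoch (a * q) q M"
      using a0 unfolding aM[symmetric] by (simp add: qM mult_ac)
    have bM: "qpoch (q * a / b) q M = qpoch (q * a / b) q m * qpoch (q * a / b * q ^ m) q p"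
      "qpoch (q * a / c) q M = qpoch (q * a / c) q m * qpoch (q * a / c * q ^ m) q p"
      by (simp_all add: M qpoch_add)
    show ?thesis
      unfolding qpochs_def list.map prod_list.Cons prod_list.Nil rev1[OF m] r bM mult.commute[of q a, symmetric]
      using s0[of m] den a0 by (simp add: p_def mult_ac)
  qed
  finally show ?thesis by (simp add: E_def s_def)
qed

text \<open>The first product is $(-1)^m q^{m(m-1)/2-Mm}$, the second the same with $N$, so the
  signs cancel. This trades the quadratic power of the 6W5 sum for the reversal products of the two
  inner evaluations and leaves $q^{M+N}$ for the argument of the series.\<close>

lemma prod_neg_powers:
  fixes q :: complex
  assumes "q \<noteq> 0"
  shows "q ^ (m * (m - 1)) = (\<Prod>j<m. - (q ^ j / q ^ M)) * (\<Prod>j<m. - (q ^ j / q ^ N)) * (q ^ (M + N)) ^ m"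
proof -
  have "(\<Prod>j<m. - (q ^ j / q ^ M)) * (\<Prod>j<m. - (q ^ j / q ^ N)) * (q ^ (M + N)) ^ m =
        (\<Prod>j<m. q ^ j * q ^ j)"
    using assms by (induction m) (simp_all add: power_add field_simps)
  also have "\<dots> = q ^ (m * (m - 1))"
  proof (induction m)
    case (Suc m)
    then show ?case by (cases m) (simp_all add: power_add mult_ac)
  qed simp
  finally show ?thesis ..
qed

section \<open>Interchanging the sums and matching the 10W9 series\<close>

theorem mainTheorem3:
  fixes M N :: nat
    and q a b c b' c' d :: complex
  assumes "q \<noteq> 0" "a \<noteq> 0" "b \<noteq> 0" "c \<noteq> 0" "b' \<noteq> 0" "c' \<noteq> 0" "d \<noteq> 0"
    and "norm q < 1"
    and "\<forall>n\<le>M. \<forall>l\<le>N. qpoch (q * a) q (n + l) \<noteq> 0"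
    and "\<forall>n\<le>M. qpochs [q, q * a / d, b * c * q powi (- int M) / a] q n \<noteq> 0"
    and "\<forall>l\<le>N. qpochs [q, q * a / d, b' * c' * q powi (- int N) / a] q l \<noteq> 0"
    and "qpochs [q * a, q * a / (b * c)] q M \<noteq> 0"
    and "qpochs [q * a, q * a / (b' * c')] q N \<noteq> 0"
    and "\<forall>m\<le>min M N.
           vwp_den a [d, b, c, b', c', q powi (- int M), q powi (- int N)] q m \<noteq> 0"
  shows "(\<Sum>n=0..M. \<Sum>l=0..N.
            qpoch (q * a / d) q (n + l) / qpoch (q * a) q (n + l)
            * (qpochs [b, c, q powi (- int M)] q n
               / qpochs [q, q * a / d, b * c * q powi (- int M) / a] q n)
            * (qpochs [b', c', q powi (- int N)] q l
               / qpochs [q, q * a / d, b' * c' * q powi (- int N) / a] q l)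
            * q ^ (n + l))
       = qpochs [q * a / b, q * a / c] q M / qpochs [q * a, q * a / (b * c)] q M
         * (qpochs [q * a / b', q * a / c'] q N / qpochs [q * a, q * a / (b' * c')] q N)
         * vwp_W a [d, b, c, b', c', q powi (- int M), q powi (- int N)] q
             (a ^ 3 * q ^ (3 + M + N) / (b * c * b' * c' * d))"
proof -
  note nzq = qpoch_q_nonzero[OF assms(8)]
  define f where "f = q * a / d"
  have fd: "f * d = a * q" using assms(7) by (simp add: f_def)
  have aq: "qpoch (a * q) q (n + l) \<noteq> 0" if "n \<le> M" "l \<le> N" for n l
    using assms(9) that by (simp add: mult.commute)
  have f0: "qpoch f q n \<noteq> 0" if "n \<le> M" for n
    using assms(10) that by (auto simp: qpochs_def f_def)
  have f0': "qpoch f q l \<noteq> 0" if "l \<le> N" for l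
    using assms(11) that by (auto simp: qpochs_def f_def)
  define co where "co m = vwp_coeff a q m * qpoch d q m * f ^ m * q ^ (m * (m - 1))
            / (qpoch q q m * qpoch f q m)" for m
  define g where "g n = qpochs [b, c, q powi (- int M)] q n / qpoch (b * c * q powi (- int M) / a) q n * q ^ n" for n
  define h where "h l = qpochs [b', c', q powi (- int N)] q l / qpoch (b' * c' * q powi (- int N) / a) q l * q ^ l" for l
  define X where "X m = (\<Sum>n\<le>M. g n * bailey_kernel a q n m)" for m
  define Y where "Y m = (\<Sum>l\<le>N. h l * bailey_kernel a q l m)" for m
  define PM where "PM = qpochs [q * a / b, q * a / c] q M / qpochs [q * a, q * a / (b * c)] q M"
  define PN where "PN = qpochs [q * a / b', q * a / c'] q N / qpochs [q * a, q * a / (b' * c')] q N"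
  define as where "as = [d, b, c, b', c', q powi (- int M), q powi (- int N)]"
  define z where "z = a ^ 3 * q ^ (3 + M + N) / (b * c * b' * c' * d)"
  have summand: "qpoch (q * a / d) q (n + l) / qpoch (q * a) q (n + l)
            * (qpochs [b, c, q powi (- int M)] q n
               / qpochs [q, q * a / d, b * c * q powi (- int M) / a] q n)
            * (qpochs [b', c', q powi (- int N)] q l
               / qpochs [q, q * a / d, b' * c' * q powi (- int N) / a] q l)
            * q ^ (n + l) =
          (\<Sum>m\<le>N. co m * (g n * bailey_kernel a q n m) * (h l * bailey_kernel a q l m))"
    if n: "n \<le> M" and l: "l \<le> N" for n l
  proof -
    \<comment> \<open>The kernel vanishes for $m>l$, so the sum may run up to \<open>N\<close>; a
      range free of \<open>n\<close> and \<open>l\<close> permits the interchange.\<close>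
    have "(\<Sum>m\<le>N. co m * (g n * bailey_kernel a q n m) * (h l * bailey_kernel a q l m)) =
       (\<Sum>m\<le>l. co m * (g n * bailey_kernel a q n m) * (h l * bailey_kernel a q l m))"
      using l by (intro sum.mono_neutral_right) (auto simp: bailey_kernel_def)
    also have "\<dots> = g n * h l * (\<Sum>m\<le>l. co m * bailey_kernel a q n m * bailey_kernel a q l m)"
      by (simp add: sum_distrib_left mult_ac)
    also have "(\<Sum>m\<le>l. co m * bailey_kernel a q n m * bailey_kernel a q l m) = qpoch f q (n + l)
         / (qpoch (a * q) q (n + l) * qpoch f q n * qpoch f q l * qpoch q q n * qpoch q q l)"
      unfolding co_def using bailey_kernel_sum[OF assms(8) fd aq[OF n l] f0[OF n] f0'[OF l]] .
    finally show ?thesis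
      by (simp add: g_def h_def qpochs_def f_def power_add mult_ac)
  qed
  have "(\<Sum>n=0..M. \<Sum>l=0..N.
            qpoch (q * a / d) q (n + l) / qpoch (q * a) q (n + l)
            * (qpochs [b, c, q powi (- int M)] q n
               / qpochs [q, q * a / d, b * c * q powi (- int M) / a] q n)
            * (qpochs [b', c', q powi (- int N)] q l
               / qpochs [q, q * a / d, b' * c' * q powi (- int N) / a] q l)
            * q ^ (n + l)) =
        (\<Sum>n\<le>M. \<Sum>l\<le>N. \<Sum>m\<le>N. co m * (g n * bailey_kernel a q n m) * (h l * bailey_kernel a q l m))"
    unfolding atMost_atLeast0[symmetric]
    by (intro sum.cong refl summand) simp_all
  also have "\<dots> = (\<Sum>n\<le>M. \<Sum>m\<le>N. \<Sum>l\<le>N. co m * (g n * bailey_kernel a q n m) * (h l * bailey_kernel a q l m))"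
    by (intro sum.cong refl sum.swap)
  also have "\<dots> = (\<Sum>m\<le>N. \<Sum>n\<le>M. \<Sum>l\<le>N. co m * (g n * bailey_kernel a q n m) * (h l * bailey_kernel a q l m))"
    by (rule sum.swap)
  also have "\<dots> = (\<Sum>m\<le>N. co m * X m * Y m)"
    by (simp only: X_def Y_def mult.assoc sum_product) (simp only: sum_distrib_left mult.assoc)
  \<comment> \<open>For $m>M$ every kernel in \<open>X m\<close> vanishes.\<close>
  also have "\<dots> = (\<Sum>m\<le>min M N. co m * X m * Y m)"
    by (rule sum.mono_neutral_right) (auto simp: X_def bailey_kernel_def)
  also have "\<dots> = (\<Sum>m\<le>min M N. PM * PN * (vwp_num a as q m / vwp_den a as q m * z ^ m))"
  proof (rule sum.cong[OF refl])
    fix m assume "m \<in> {..min M N}"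
    then have m: "m \<le> M" "m \<le> N" "m \<le> min M N" by auto
    have den: "vwp_den a as q m \<noteq> 0" using assms(14) m(3) by (simp add: as_def)
    define sM sN where "sM = (\<Prod>j<m. - (q ^ j / q ^ M))" and "sN = (\<Prod>j<m. - (q ^ j / q ^ N))"
    have s0: "sM \<noteq> 0" "sN \<noteq> 0" using assms(1) by (simp_all add: sM_def sN_def)
    have dnz: "qpoch (q * a / b) q m \<noteq> 0" "qpoch (q * a / c) q m \<noteq> 0"
      "qpoch (q * a / b') q m \<noteq> 0" "qpoch (q * a / c') q m \<noteq> 0"
      "qpoch (csqrt a) q m * qpoch (- csqrt a) q m \<noteq> 0"
      using den by (auto simp: vwp_den_def as_def qpochs_def)
    have a1: "qpoch (q * a) q (M + m) \<noteq> 0" "qpoch (q * a) q (N + m) \<noteq> 0"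
      using aq[of M m] aq[of m N] m by (simp_all add: mult.commute add.commute)
    have E: "qpoch (q * a / (b * c)) q M \<noteq> 0" "qpoch (q * a / (b' * c')) q N \<noteq> 0"
      using assms(12,13) by (auto simp: qpochs_def)
    have Xm: "X m = PM * (qpochs [b, c, q powi (- int M)] q m
            / qpochs [q * a / b, q * a / c, q * a / q powi (- int M)] q m)
         * ((q * a / (b * c)) ^ m / sM)"
      unfolding X_def g_def PM_def sM_def
      by (rule bailey_kernel_Saalschuetz) (use assms m a1 E dnz in auto)
    have Ym: "Y m = PN * (qpochs [b', c', q powi (- int N)] q m
            / qpochs [q * a / b', q * a / c', q * a / q powi (- int N)] q m)
         * ((q * a / (b' * c')) ^ m / sN)"
      unfolding Y_def h_def PN_def sN_def
      by (rule bailey_kernel_Saalschuetz) (use assms m a1 E dnz in auto)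
    \<comment> \<open>The argument is the product of the two Saalschuetz ratios, the 6W5 ratio
      \<open>f\<close> and the $q^{M+N}$ supplied by \<open>prod_neg_powers\<close>.\<close>
    have "z = q * a / (b * c) * (q * a / (b' * c')) * f * q ^ (M + N)"
      by (simp add: z_def f_def power_add power3_eq_cube mult_ac)
    then have zm: "z ^ m = (q * a / (b * c)) ^ m * (q * a / (b' * c')) ^ m * f ^ m * (q ^ (M + N)) ^ m"
      by (simp only: power_mult_distrib)
    have pw: "q ^ (m * (m - 1)) = sM * sN * (q ^ (M + N)) ^ m"
      unfolding sM_def sN_def by (rule prod_neg_powers[OF assms(1)])
    have v: "vwp_coeff a q m = qpoch a q m * qpoch (q * csqrt a) q m * qpoch (- q * csqrt a) q m
         / (qpoch (csqrt a) q m * qpoch (- csqrt a) q m)"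
      using vwp_coeff_eq[OF power2_csqrt dnz(5)] by simp
    define R where "R = qpochs [b, c, q powi (- int M)] q m
            / qpochs [q * a / b, q * a / c, q * a / q powi (- int M)] q m"
    define R' where "R' = qpochs [b', c', q powi (- int N)] q m
            / qpochs [q * a / b', q * a / c', q * a / q powi (- int N)] q m"
    have W: "vwp_num a as q m / vwp_den a as q m =
        vwp_coeff a q m * qpoch d q m / (qpoch q q m * qpoch f q m) * R * R'"
      unfolding v R_def R'_def
      by (simp add: vwp_num_def vwp_den_def as_def qpochs_def f_def mult_ac)
    show "co m * X m * Y m = PM * PN * (vwp_num a as q m / vwp_den a as q m * z ^ m)"
      unfolding W zm Xm Ym R_def[symmetric] R'_def[symmetric] co_def pw
      using s0 by simp
  qed
  also have "\<dots> = PM * PN * (\<Sum>m\<le>min M N. vwp_num a as q m / vwp_den a as q m * z ^ m)"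
    by (simp add: sum_distrib_left)
  also have "(\<Sum>m\<le>min M N. vwp_num a as q m / vwp_den a as q m * z ^ m) = vwp_W a as q z"
    unfolding vwp_W_def
  proof (rule suminf_finite[symmetric])
    \<comment> \<open>Past \<open>min M N\<close> the denominators may vanish, but the numerator is
      0 and a quotient with numerator 0 is 0 for every denominator.\<close>
    fix m assume "m \<notin> {..min M N}"
    then have "M < m \<or> N < m" by auto
    \<comment> \<open>The factor with index \<open>K\<close> is $1-q^{-K}q^K=0$.\<close>
    moreover have "qpoch (q powi (- int K)) q m = 0" if "K < m" for K
      using that assms(1) unfolding qpoch_def
      by (intro prod_zero) (auto simp: power_int_minus intro!: bexI[of _ K])
    ultimately show "vwp_num a as q m / vwp_den a as q m * z ^ m = 0"
      by (auto simp: vwp_num_def as_def qpochs_def)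
  qed simp
  finally show ?thesis by (simp only: PM_def PN_def as_def z_def)
qed

end
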